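(* Consider the storage arbitrage setting given in the context, with value function derivative $v_t$ (extended to $\mathbb{R}$ by $-\infty$ above $E$ and $+\infty$ below $0$) and random price $\lambda_t$ with density $f_t$ and cumulative distribution function $F_t$. Then for $e\in[0,E]$ the risk-neutral value function derivative $v_{t-1}(e)=\mathbb{E}[q_{t-1}(e)]$ is given by $$\begin{aligned} v_{t-1}(e)={}& v_t(e+P\eta)\,F_t\big(v_t(e+P\eta)\eta\big)+\frac{1}{\eta}\int_{v_t(e+P\eta)\eta}^{v_t(e)\eta} u f_t(u)\,du\\ &+v_t(e)\Big[F_t\big([v_t(e)/\eta+c]^+\big)-F_t\big(v_t(e)\eta\big)\Big]\\ &+\eta\int_{[v_t(e)/\eta+c]^+}^{[v_t(e-P/\eta)/\eta+c]^+} w f_t(w)\,dw\\ &-c\eta\Big[F_t\big([v_t(e-P/\eta)/\eta+c]^+\big)-F_t\big([v_t(e)/\eta+c]^+\big)\Big]\\ &+v_t(e-P/\eta)\Big[1-F_t\big([v_t(e-P/\eta)/\eta+c]^+\big)\Big].\end{aligned}$$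
   Context: $[x]^+=\max\{x,0\}$. Parameters: power rating $P>0$, energy capacity $E>0$, efficiency $\eta\in(0,1]$, marginal discharge cost $c>0$. The prices $\lambda_1,\dots,\lambda_T$ are independent real random variables with finite mean; $\lambda_t$ has probability density $f_t$ and cumulative distribution function $F_t$. For $1\le t\le T$, given a value function $V_t:[0,E]\to\mathbb{R}$, define for a starting state of charge $e\in[0,E]$ the random variable (a function of $\lambda_t$) $$Q_{t-1}(e)=\max_{p^{\mathrm c},\,p^{\mathrm d},\,e_t}\ \lambda_t(p^{\mathrm d}-p^{\mathrm c})-c\,p^{\mathrm d}+V_t(e_t)$$ subject to $0\le p^{\mathrm c}\le P$, $0\le p^{\mathrm d}\le P$, $p^{\mathrm d}>0$ only if $\lambda_t>0$ (this replaces the requirement that $p^{\mathrm c}$ or $p^{\mathrm d}$ be zero), $e_t-e=-p^{\mathrm d}/\eta+p^{\mathrm c}\eta$, and $0\le e_t\le E$. The value functions satisfy $V_{t-1}(e)=\mathbb{E}[Q_{t-1}(e)]$, with $V_T$ a given end-value function. Standing assumptions: $V_t$ is concave and differentiable on $[0,E]$, and $Q_{t-1}$ is treated as differentiable on $[0,E]$ (derivatives at the endpoints $0$ and $E$ being one-sided), so that $q_{t-1}(e)=\frac{d}{de}Q_{t-1}(e)$ is defined (almost surely) at the point $e$ considered. On $[0,E]$, $v_{t-1}(e)=\mathbb{E}[q_{t-1}(e)]$, i.e. the derivative of $V_{t-1}$ with differentiation moved inside the expectation. The function $v_t$ is the derivative of $V_t$ on $[0,E]$ (monotonically decreasing), extended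 by $v_t(e)=-\infty$ for $e>E$ and $v_t(e)=+\infty$ for $e<0$. Conventions for infinite values: $F_t(-\infty)=0$, $F_t(+\infty)=1$, $[+\infty]^+=+\infty$, and $(\pm\infty)\cdot 0=0$, so the first term is $0$ if $e+P\eta>E$ and the last term is $0$ if $e-P/\eta<0$.
   Formalization: The formula fails in two corner cases, so it is additionally assumed that λ_t ≥ v_t(E)η almost surely if e=0 and Pη=E, and that λ_t ≤ [v_t(0)/η+c]^+ almost surely if e=E and P/η=E. *)

theory Defs
  imports "HOL-Probability.Probability"
begin

definition feasible :: "real \<Rightarrow> real \<Rightarrow> real \<Rightarrow> real \<Rightarrow> real \<Rightarrow> (real \<times> real \<times> real) set" where
  "feasible P E \<eta> p e =
     {(pc, pd, e'). 0 \<le> pc \<and> pc \<le> P \<and> 0 \<le> pd \<and> pd \<le> P \<and> (pd > 0 \<longrightarrow> p > 0) \<and>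
        e' - e = - pd / \<eta> + pc * \<eta> \<and> 0 \<le> e' \<and> e' \<le> E}"

text \<open>
  Here \<open>p\<close> is the realised price, \<open>e\<close> the starting state of charge and \<open>W\<close> the value function at
  the end of the period. For \<open>e \<in> {0..E}\<close> the feasible set is compact and nonempty, so the
  supremum is a maximum whenever \<open>W\<close> is continuous on \<open>{0..E}\<close>.
\<close>

definition Qval :: "real \<Rightarrow> real \<Rightarrow> real \<Rightarrow> real \<Rightarrow> (real \<Rightarrow> real) \<Rightarrow> real \<Rightarrow> real \<Rightarrow> real" where
  "Qval P E \<eta> c W p e =
     (SUP (pc, pd, e') \<in> feasible P E \<eta> p e. p * (pd - pc) - c * pd + W e')"

text \<open>Differentiating within \<open>{0..E}\<close> makes the derivatives at \<open>0\<close> and \<open>E\<close> one-sided.\<close>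

definition qval :: "real \<Rightarrow> real \<Rightarrow> real \<Rightarrow> real \<Rightarrow> (real \<Rightarrow> real) \<Rightarrow> real \<Rightarrow> real \<Rightarrow> real" where
  "qval P E \<eta> c W p e = vector_derivative (Qval P E \<eta> c W p) (at e within {0..E})"

definition value_deriv :: "real \<Rightarrow> (real \<Rightarrow> real) \<Rightarrow> real \<Rightarrow> ereal" where
  "value_deriv E W x =
     (if x < 0 then \<infinity> else if x > E then - \<infinity>
      else ereal (vector_derivative W (at x within {0..E})))"

text \<open>
  At a point \<open>e\<close> with \<open>e + P * \<eta> = E\<close> or \<open>e - P / \<eta> = 0\<close> the power and energy limits bind
  simultaneously and \<^const>\<open>Qval\<close> has a kink for prices leading to full charge or discharge. In
  the interior, differentiability excludes this, but if \<open>e = 0\<close> (and \<open>P * \<eta> = E\<close>) or \<open>e = E\<close> (and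
  \<open>P / \<eta> = E\<close>) the one-sided derivative exists and differs from the value of
  \<^const>\<open>value_deriv\<close> at the far end. Such prices then have to be excluded explicitly.
\<close>

definition cdf_ext :: "real measure \<Rightarrow> ereal \<Rightarrow> real" where
  "cdf_ext D x = (case x of ereal r \<Rightarrow> cdf D r | PInfty \<Rightarrow> 1 | MInfty \<Rightarrow> 0)"

definition pos_part :: "ereal \<Rightarrow> ereal" where
  "pos_part x = max x 0"

end

theory Submission
  imports Defs
begin

text \<open>
  For a fixed price, linear programming duality gives the derivative of the one-period value in the
  state of charge: if \<open>\<sigma>\<close> is a supergradient of the end value at the target state and the controls
  maximise the objective linearised with slope \<open>\<sigma>\<close>, then \<open>\<sigma>\<close> is a supergradient of the period
  value. A suboptimal strategy (keep the controls, or keep the target) bounds the period value from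
  below with the same slope, so the two bounds squeeze the derivative. Five price ranges arise: full
  charge, partial charge, idle, partial discharge, full discharge; the price has no atoms, so the
  four thresholds do not matter, and integrating the resulting piecewise affine function of the
  price gives the formula.

  If full power exactly fills or empties the storage from an interior state, there are two distinct
  supergradients and the period value is not differentiable there. Such prices have probability
  zero by hypothesis, but measurability of the derivative still needs its (constant) junk value.
\<close>

section \<open>Derivatives and supergradients\<close>

text \<open>Along the segment from \<open>z\<close> to \<open>x\<close>, concavity bounds the
  difference quotients in the parameter \<open>t\<close> below by \<open>f x - f z\<close>, and the
  chain rule gives their limit. Working within the segment covers one-sided derivatives at boundary
  points of \<open>S\<close>.\<close>

lemma concave_on_tangent_le:
  fixes f :: "real \<Rightarrow> real"
  assumes conc: "concave_on S f" and x: "x \<in> S" and z: "z \<in> S"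
    and d: "(f has_real_derivative d) (at z within S)"
  shows "f x \<le> f z + d * (x - z)"
proof (cases "x = z")
  case False
  define \<gamma> where "\<gamma> t = z + t * (x - z)" for t
  have conv: "\<gamma> t = (1 - t) *\<^sub>R z + t *\<^sub>R x" for t
    by (simp add: \<gamma>_def algebra_simps)
  have \<gamma>S: "\<gamma> ` {0..1} \<subseteq> S"
    using convexD_alt[OF concave_on_imp_convex[OF conc] z x] by (auto simp: conv)
  have "(\<gamma> has_real_derivative (x - z)) (at 0 within {0..1})"
    unfolding \<gamma>_def by (auto intro!: derivative_eq_intros)
  moreover have "(f has_real_derivative d) (at (\<gamma> 0) within \<gamma> ` {0..1})"
    using DERIV_subset[OF d \<gamma>S] by (simp add: \<gamma>_def)
  ultimately have "((\<lambda>t. f (\<gamma> t)) has_real_derivative d * (x - z)) (at 0 within {0..1})"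
    using DERIV_image_chain[of f d \<gamma> 0 "{0..1}" "x - z"] by (simp add: o_def)
  then have lim: "((\<lambda>t. (f (\<gamma> t) - f (\<gamma> 0)) / (t - 0)) \<longlongrightarrow> d * (x - z)) (at 0 within {0..1})"
    by (simp add: has_field_derivative_iff)
  have "eventually (\<lambda>t. f x - f z \<le> (f (\<gamma> t) - f (\<gamma> 0)) / (t - 0)) (at (0::real) within {0..1})"
    unfolding eventually_at_filter
  proof (intro always_eventually allI impI)
    fix t :: real assume t: "t \<noteq> 0" "t \<in> {0..1}"
    have "(1 - t) * f z + t * f x \<le> f (\<gamma> t)"
      using concave_onD[OF conc _ _ z x, of t] t unfolding conv by simp
    then have "t * (f x - f z) \<le> f (\<gamma> t) - f (\<gamma> 0)"
      by (simp add: \<gamma>_def algebra_simps)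
    then show "f x - f z \<le> (f (\<gamma> t) - f (\<gamma> 0)) / (t - 0)"
      using t by (simp add: field_simps)
  qed
  moreover have "at (0::real) within {0..1} \<noteq> bot"
    by (simp add: trivial_limit_within)
  ultimately have "f x - f z \<le> d * (x - z)"
    using tendsto_lowerbound[OF lim] by blast
  then show ?thesis by simp
qed simp

text \<open>Difference quotients to the left of \<open>z\<close> are at least \<open>s\<close>,
  those to the right at most \<open>s\<close>. An end point of the interval has only one side, hence
  two separate bounds.\<close>

lemma derivative_vs_supergradient:
  fixes F :: "real \<Rightarrow> real"
  assumes d: "(F has_real_derivative d) (at z within {a..b})" and z: "z \<in> {a..b}"
    and sup: "\<And>x. x \<in> {a..b} \<Longrightarrow> F x \<le> F z + s * (x - z)"
  shows "a < z \<Longrightarrow> s \<le> d" and "z < b \<Longrightarrow> d \<le> s"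
proof -
  have q: "((\<lambda>x. (F x - F z) / (x - z)) \<longlongrightarrow> d) (at z within {a..b})"
    using d by (simp add: has_field_derivative_iff)
  show "s \<le> d" if "a < z"
  proof (rule tendsto_lowerbound)
    have "at z within {a..<z} \<le> at z within {a..b}"
      using z by (intro at_le) auto
    then show "((\<lambda>x. (F x - F z) / (x - z)) \<longlongrightarrow> d) (at z within {a..<z})"
      using q tendsto_mono by blast
    show "\<forall>\<^sub>F x in at z within {a..<z}. s \<le> (F x - F z) / (x - z)"
      unfolding eventually_at_filter
    proof (intro always_eventually allI impI)
      fix x assume "x \<noteq> z" "x \<in> {a..<z}"
      then show "s \<le> (F x - F z) / (x - z)"
        using sup[of x] z by (simp add: neg_le_divide_eq algebra_simps)
    qed
    show "at z within {a..<z} \<noteq> bot"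
      using that by (simp add: trivial_limit_within)
  qed
  show "d \<le> s" if "z < b"
  proof (rule tendsto_upperbound)
    have "at z within {z<..b} \<le> at z within {a..b}"
      using z by (intro at_le) auto
    then show "((\<lambda>x. (F x - F z) / (x - z)) \<longlongrightarrow> d) (at z within {z<..b})"
      using q tendsto_mono by blast
    show "\<forall>\<^sub>F x in at z within {z<..b}. (F x - F z) / (x - z) \<le> s"
      unfolding eventually_at_filter
    proof (intro always_eventually allI impI)
      fix x assume "x \<noteq> z" "x \<in> {z<..b}"
      then show "(F x - F z) / (x - z) \<le> s"
        using sup[of x] z by (simp add: divide_le_eq algebra_simps)
    qed
    show "at z within {z<..b} \<noteq> bot"
      using that by (simp add: trivial_limit_within)
  qed
qed

text \<open>Relative to the line of slope \<open>s\<close> through the common value at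
  \<open>z\<close>, \<open>F\<close> lies between \<open>\<phi>\<close> and zero, so the error of
  its difference quotient is dominated by that of \<open>\<phi>\<close>.\<close>

lemma has_real_derivative_squeeze:
  fixes F \<phi> :: "real \<Rightarrow> real"
  assumes \<phi>: "(\<phi> has_real_derivative s) (at z within S)" and eq: "\<phi> z = F z"
    and low: "\<forall>\<^sub>F x in at z within S. \<phi> x \<le> F x"
    and up: "\<forall>\<^sub>F x in at z within S. F x \<le> F z + s * (x - z)"
  shows "(F has_real_derivative s) (at z within S)"
proof -
  have "((\<lambda>x. (\<phi> x - \<phi> z) / (x - z) - s) \<longlongrightarrow> 0) (at z within S)"
    using \<phi> by (simp add: has_field_derivative_iff LIM_zero_iff)
  moreover have "\<forall>\<^sub>F x in at z within S.
      norm ((F x - F z) / (x - z) - s) \<le> norm ((\<phi> x - \<phi> z) / (x - z) - s)"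
  proof -
    have "\<forall>\<^sub>F x in at z within S. x \<noteq> z"
      by (simp add: eventually_at_filter)
    then show ?thesis using low up
    proof eventually_elim
      case (elim x)
      have *: "(g x - g z) / (x - z) - s = (g x - g z - s * (x - z)) / (x - z)" for g :: "real \<Rightarrow> real"
        using elim by (simp add: field_simps)
      show ?case
        unfolding * using elim eq by (auto simp: abs_divide intro!: divide_right_mono)
    qed
  qed
  ultimately have "((\<lambda>x. (F x - F z) / (x - z) - s) \<longlongrightarrow> 0) (at z within S)"
    by (rule Lim_null_comparison[rotated, OF tendsto_norm_zero])
  then show ?thesis
    by (simp add: has_field_derivative_iff LIM_zero_iff)
qed

text \<open>The choice defining \<open>vector_derivative\<close> then ranges over an everywhere
  false predicate, so the default value depends on neither \<open>f\<close> nor \<open>net\<close>.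
  This constancy serves the measurability argument.\<close>

lemma vector_derivative_not_differentiable:
  assumes "\<not> f differentiable net"
  shows "vector_derivative f net = (SOME d. False)"
  using assms unfolding vector_derivative_def
  by (metis (mono_tags, lifting) differentiableI_vector)

section \<open>The value of one period at a fixed price\<close>

locale storage_period =
  fixes P E \<eta> c :: real and W :: "real \<Rightarrow> real"
  assumes P_pos: "P > 0" and E_pos: "E > 0" and \<eta>_pos: "0 < \<eta>" and \<eta>_le_1: "\<eta> \<le> 1"
    and c_pos: "c > 0"
    and concave: "concave_on {0..E} W" and differentiable: "W differentiable_on {0..E}"
begin

abbreviation Q :: "real \<Rightarrow> real \<Rightarrow> real" where
  "Q \<equiv> Qval P E \<eta> c W"

definition w :: "real \<Rightarrow> real" where
  "w z = vector_derivative W (at z within {0..E})"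

lemma w_deriv: "z \<in> {0..E} \<Longrightarrow> (W has_real_derivative w z) (at z within {0..E})"
  using differentiable unfolding differentiable_on_def w_def
  by (simp add: has_real_derivative_iff_has_vector_derivative vector_derivative_works)

lemma tangent: "z \<in> {0..E} \<Longrightarrow> \<forall>x\<in>{0..E}. W x \<le> W z + w z * (x - z)"
  using concave_on_tangent_le[OF concave _ _ w_deriv] by blast

text \<open>Add the tangent inequalities at \<open>x\<close> and \<open>y\<close>, each evaluated at
  the other point.\<close>

lemma w_antimono: "x \<in> {0..E} \<Longrightarrow> y \<in> {0..E} \<Longrightarrow> x \<le> y \<Longrightarrow> w y \<le> w x"
proof -
  assume *: "x \<in> {0..E}" "y \<in> {0..E}" "x \<le> y"
  have "(w y - w x) * (y - x) \<le> 0"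
    using bspec[OF tangent[OF *(1)] *(2)] bspec[OF tangent[OF *(2)] *(1)] by (simp add: algebra_simps)
  then show ?thesis
    using * by (cases "x = y") (auto simp: mult_le_0_iff)
qed

text \<open>The target maximises \<open>W x - \<sigma> * x\<close> over a compact interval. Choosing
  it this way avoids inverting \<open>w\<close>, which may be flat or may miss the value
  \<open>\<sigma>\<close>.\<close>

lemma ex_target: "\<exists>z\<in>{0..E}. \<forall>x\<in>{0..E}. W x \<le> W z + \<sigma> * (x - z)"
proof -
  have "continuous_on {0..E} (\<lambda>x. W x - \<sigma> * x)"
    using differentiable_imp_continuous_on[OF differentiable] by (intro continuous_intros)
  then obtain z where "z \<in> {0..E}" "\<forall>x\<in>{0..E}. W x - \<sigma> * x \<le> W z - \<sigma> * z"
    using continuous_attains_sup[of "{0..E}" "\<lambda>x. W x - \<sigma> * x"] E_pos by auto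
  then show ?thesis by (intro bexI[of _ z]) (auto simp: algebra_simps)
qed

text \<open>
  Discharging \<open>pd\<close> and charging \<open>pc\<close> changes the objective linearised with slope \<open>\<sigma>\<close>
  by \<open>pd * (p - c - \<sigma> / \<eta>) + pc * (\<sigma> * \<eta> - p)\<close>.
\<close>

definition optimal_controls :: "real \<Rightarrow> real \<Rightarrow> real \<Rightarrow> real \<Rightarrow> bool" where
  "optimal_controls \<sigma> p pc0 pd0 \<longleftrightarrow>
    (\<forall>pc\<in>{0..P}. \<forall>pd\<in>{0..P}. (pd > 0 \<longrightarrow> p > 0) \<longrightarrow>
      pd * (p - c - \<sigma> / \<eta>) + pc * (\<sigma> * \<eta> - p) \<le> pd0 * (p - c - \<sigma> / \<eta>) + pc0 * (\<sigma> * \<eta> - p))"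

text \<open>Weak duality: replacing the end value by its affine majorant and eliminating
  \<open>e'\<close> through the dynamics leaves the linearised objective, which the given controls
  maximise. The bound is attained at \<open>e\<close>, so it yields both the value and a
  supergradient there.\<close>

lemma Q_supergradient:
  assumes W: "\<forall>x\<in>{0..E}. W x \<le> W z + \<sigma> * (x - z)"
    and feas: "(pc0, pd0, z) \<in> feasible P E \<eta> p e"
    and opt: "optimal_controls \<sigma> p pc0 pd0"
    and e: "e \<in> {0..E}"
  shows "Q p e = p * (pd0 - pc0) - c * pd0 + W z"
    and "y \<in> {0..E} \<Longrightarrow> Q p y \<le> Q p e + \<sigma> * (y - e)"
    and "(pc, pd, e') \<in> feasible P E \<eta> p y \<Longrightarrow> p * (pd - pc) - c * pd + W e' \<le> Q p y"
proof -
  let ?obj = "\<lambda>(pc, pd, e'). p * (pd - pc) - c * pd + W e'"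
  define A where "A = p * (pd0 - pc0) - c * pd0 + W z"
  have bnd: "?obj r \<le> A + \<sigma> * (y - e)" if "r \<in> feasible P E \<eta> p y" for r y
  proof -
    obtain pc pd e' where r: "r = (pc, pd, e')" by (cases r)
    have f: "0 \<le> pc" "pc \<le> P" "0 \<le> pd" "pd \<le> P" "pd > 0 \<Longrightarrow> p > 0"
      "e' = y - pd / \<eta> + pc * \<eta>" "e' \<in> {0..E}"
      using that by (auto simp: r feasible_def)
    have z: "z = e - pd0 / \<eta> + pc0 * \<eta>"
      using feas by (auto simp: feasible_def)
    have "p * (pd - pc) - c * pd + W e' \<le> p * (pd - pc) - c * pd + W z + \<sigma> * (e' - z)"
      using bspec[OF W f(7)] by simp
    also have "\<dots> = W z + \<sigma> * (y - z) + (pd * (p - c - \<sigma> / \<eta>) + pc * (\<sigma> * \<eta> - p))"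
      by (simp add: f(6) algebra_simps)
    also have "\<dots> \<le> W z + \<sigma> * (y - z) + (pd0 * (p - c - \<sigma> / \<eta>) + pc0 * (\<sigma> * \<eta> - p))"
      using opt f(1-5) by (simp add: optimal_controls_def)
    also have "\<dots> = A + \<sigma> * (y - e)"
      \<comment> \<open>Only the \<open>z\<close> in \<open>\<sigma> * (y - z)\<close> is expanded;
        the argument of \<open>W\<close> must stay.\<close>
      unfolding A_def by (subst (2) z) (simp add: algebra_simps)
    finally show ?thesis by (simp add: r)
  qed
  \<comment> \<open>Besides the estimate, \<open>bnd\<close> supplies the boundedness that gives the
    supremum its meaning.\<close>
  have ge: "?obj r \<le> Q p y" if "r \<in> feasible P E \<eta> p y" for r y
    unfolding Qval_def using that bnd[of _ y] by (intro cSUP_upper bdd_aboveI2) blast+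
  then show "p * (pd - pc) - c * pd + W e' \<le> Q p y" if "(pc, pd, e') \<in> feasible P E \<eta> p y"
    using ge[OF that] by simp
  have le: "Q p y \<le> A + \<sigma> * (y - e)" if "y \<in> {0..E}" for y
  proof -
    \<comment> \<open>Idling is feasible from every state in range, so the supremum is over a
      nonempty set.\<close>
    have "(0, 0, y) \<in> feasible P E \<eta> p y"
      using that P_pos by (auto simp: feasible_def)
    then show ?thesis
      unfolding Qval_def using bnd[of _ y] by (intro cSUP_least) auto
  qed
  show eq: "Q p e = p * (pd0 - pc0) - c * pd0 + W z"
    using le[OF e] ge[OF feas] by (simp add: A_def)
  show "Q p y \<le> Q p e + \<sigma> * (y - e)" if "y \<in> {0..E}"
    using le[OF that] eq by (simp add: A_def)
qed

text \<open>Keeping the controls moves the target in parallel with the initial state, so the shifted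
  \<open>W\<close> is a lower bound with slope \<open>w z\<close>. The shifted target stays in range
  if \<open>z = e\<close> or \<open>z\<close> is interior; the first case covers idling at the end
  points.\<close>

lemma Q_deriv_fixed_controls:
  assumes feas: "(pc0, pd0, z) \<in> feasible P E \<eta> p e" and e: "e \<in> {0..E}"
    and opt: "optimal_controls (w z) p pc0 pd0"
    and z: "z = e \<or> 0 < z \<and> z < E"
  shows "(Q p has_real_derivative w z) (at e within {0..E})"
proof -
  have z0: "z \<in> {0..E}" using z e by auto
  note sg = Q_supergradient[OF tangent[OF z0] feas opt e]
  let ?\<phi> = "\<lambda>y. p * (pd0 - pc0) - c * pd0 + W (z + (y - e))"
  have "((\<lambda>y. W (z + (y - e))) has_real_derivative w z) (at e within {0..E})"
  proof (cases "z = e")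
    case True
    then show ?thesis using w_deriv[OF z0] by simp
  next
    case False
    \<comment> \<open>The translation carries \<open>{0..E}\<close> around \<open>e\<close> to a
      different set around \<open>z\<close>, so a two-sided derivative at \<open>z\<close> is
      used.\<close>
    then have "at z within {0..E} = at z"
      using z by (intro at_within_interior) simp
    then have "(W has_real_derivative w z) (at z)"
      using w_deriv[OF z0] by simp
    then have "((\<lambda>y. W (y + (z - e))) has_real_derivative w z) (at e)"
      using DERIV_shift[of W "w z" e "z - e"] by simp
    then show ?thesis
      by (simp add: algebra_simps has_field_derivative_at_within)
  qed
  moreover have eq: "?\<phi> e = Q p e"
    by (simp add: sg(1))
  ultimately have \<phi>: "(?\<phi> has_real_derivative w z) (at e within {0..E})"
    by (auto intro!: derivative_eq_intros)
  have "\<forall>\<^sub>F y in at e within {0..E}. z + (y - e) \<in> {0..E}"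
  proof (cases "z = e")
    case False
    \<comment> \<open>These are the \<open>y\<close> with
      \<open>0 < z + (y - e) < E\<close>.\<close>
    then have "e \<in> {e - z<..<e - z + E}" using z by auto
    then show ?thesis
      unfolding eventually_at_topological
      by (intro exI[of _ "{e - z<..<e - z + E}"]) auto
  qed (simp add: eventually_at_filter)
  then have "\<forall>\<^sub>F y in at e within {0..E}. ?\<phi> y \<le> Q p y"
  proof eventually_elim
    case (elim y)
    then have "(pc0, pd0, z + (y - e)) \<in> feasible P E \<eta> p y"
      using feas by (auto simp: feasible_def)
    then show ?case by (rule sg(3))
  qed
  moreover have "\<forall>\<^sub>F y in at e within {0..E}. Q p y \<le> Q p e + w z * (y - e)"
    using sg(2) by (simp add: eventually_at_filter)
  ultimately show ?thesis
    by (rule has_real_derivative_squeeze[where \<phi> = ?\<phi> and F = "Q p", OF \<phi> eq])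
qed

text \<open>Round-trip loss: since \<open>\<eta> \<le> 1\<close>, a positive price satisfies
  \<open>p \<le> p / \<eta> / \<eta> \<le> \<sigma> / \<eta>\<close>, so discharging gains nothing
  even before paying \<open>c\<close>. At a negative price the first inequality can fail; there the
  feasibility condition forbids discharging.\<close>

lemma no_discharge_when_charging:
  assumes "0 \<le> pd" and "pd > 0 \<Longrightarrow> p > 0" and "p \<le> \<sigma> * \<eta>"
  shows "pd * (p - c - \<sigma> / \<eta>) \<le> 0"
proof (cases "pd > 0")
  case True
  have "p * (\<eta> * \<eta>) \<le> p * 1"
    using assms(2)[OF True] \<eta>_pos \<eta>_le_1 by (intro mult_left_mono mult_le_one) auto
  then have "p \<le> p / \<eta> / \<eta>" using \<eta>_pos by (simp add: field_simps)
  also have "p / \<eta> / \<eta> \<le> \<sigma> / \<eta>"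
    using assms(3) \<eta>_pos by (intro divide_right_mono) (auto simp: field_simps)
  finally show ?thesis using True c_pos by (simp add: mult_le_0_iff)
qed (use assms in auto)

text \<open>The same loss read backwards:
  \<open>\<sigma> * \<eta> \<le> (p - c) * \<eta> * \<eta> \<le> p\<close> at a positive
  price.\<close>

lemma no_charge_when_discharging:
  assumes "0 \<le> pc" and "p > 0" and "\<sigma> \<le> (p - c) * \<eta>"
  shows "pc * (\<sigma> * \<eta> - p) \<le> 0"
proof -
  have "p * (\<eta> * \<eta>) \<le> p * 1"
    using assms(2) \<eta>_pos \<eta>_le_1 by (intro mult_left_mono mult_le_one) auto
  moreover have "0 \<le> c * (\<eta> * \<eta>)" using c_pos by simp
  moreover have "\<sigma> * \<eta> \<le> (p - c) * \<eta> * \<eta>"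
    using assms(3) \<eta>_pos by (intro mult_right_mono) auto
  ultimately have "\<sigma> * \<eta> - p \<le> 0" by (simp add: algebra_simps)
  then show ?thesis using assms(1) by (simp add: mult_le_0_iff)
qed

text \<open>The slope \<open>p / \<eta>\<close> makes the coefficient
  \<open>\<sigma> * \<eta> - p\<close> vanish, so every charge is equally good in the linearised
  problem, in particular the one that ends at \<open>z\<close>.\<close>

lemma charge_supergradient:
  assumes z: "z \<in> {0..E}" "\<forall>x\<in>{0..E}. W x \<le> W z + p / \<eta> * (x - z)"
    and e: "e \<in> {0..E}" "e \<le> z" "z \<le> e + P * \<eta>"
  shows "Q p e = p * (0 - (z - e) / \<eta>) - c * 0 + W z"
    and "y \<in> {0..E} \<Longrightarrow> Q p y \<le> Q p e + p / \<eta> * (y - e)"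
    and "(pc, pd, e') \<in> feasible P E \<eta> p y \<Longrightarrow> p * (pd - pc) - c * pd + W e' \<le> Q p y"
proof -
  have feas: "((z - e) / \<eta>, 0, z) \<in> feasible P E \<eta> p e"
    using z(1) e \<eta>_pos P_pos by (auto simp: feasible_def field_simps)
  have opt: "optimal_controls (p / \<eta>) p ((z - e) / \<eta>) 0"
    using no_discharge_when_charging[of _ p "p / \<eta>"] \<eta>_pos by (simp add: optimal_controls_def)
  note sg = Q_supergradient[OF z(2) feas opt e(1)]
  show "Q p e = p * (0 - (z - e) / \<eta>) - c * 0 + W z"
    and "y \<in> {0..E} \<Longrightarrow> Q p y \<le> Q p e + p / \<eta> * (y - e)"
    and "(pc, pd, e') \<in> feasible P E \<eta> p y \<Longrightarrow> p * (pd - pc) - c * pd + W e' \<le> Q p y"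
    by (rule sg; assumption)+
qed

text \<open>Here the target is kept and the charge varies with the state, giving an affine lower
  bound of slope \<open>p / \<eta>\<close>. The charge stays within \<open>{0..P}\<close> near
  \<open>e\<close>: strict inequalities give a neighbourhood, and in the cases \<open>z = E\<close>
  or \<open>e = 0\<close> with \<open>z = e + P * \<eta>\<close> the limits of the storage itself
  suffice.\<close>

lemma Q_deriv_charge:
  assumes z: "z \<in> {0..E}" "\<forall>x\<in>{0..E}. W x \<le> W z + p / \<eta> * (x - z)"
    and e: "e \<in> {0..E}" "e < z \<or> z = E" "z < e + P * \<eta> \<or> e = 0 \<and> z = e + P * \<eta>"
  shows "(Q p has_real_derivative p / \<eta>) (at e within {0..E})"
proof -
  have "e \<le> z" "z \<le> e + P * \<eta>" using e by auto
  note sg = charge_supergradient[OF z e(1) this]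
  let ?\<phi> = "\<lambda>y. p * (0 - (z - y) / \<eta>) - c * 0 + W z"
  have eq: "?\<phi> e = Q p e"
    by (simp add: sg(1))
  have \<phi>: "(?\<phi> has_real_derivative p / \<eta>) (at e within {0..E})"
    using \<eta>_pos by (auto intro!: derivative_eq_intros)
  have "\<forall>\<^sub>F y in at e within {0..E}. y \<le> z"
    using e unfolding eventually_at_topological
    by (intro exI[of _ "if e < z then {..<z} else UNIV"]) auto
  moreover have "\<forall>\<^sub>F y in at e within {0..E}. z \<le> y + P * \<eta>"
    using e unfolding eventually_at_topological
    by (intro exI[of _ "if e = 0 \<and> z = e + P * \<eta> then UNIV else {z - P * \<eta><..}"]) auto
  ultimately have "\<forall>\<^sub>F y in at e within {0..E}. ?\<phi> y \<le> Q p y"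
  proof eventually_elim
    case (elim y)
    then have "((z - y) / \<eta>, 0, z) \<in> feasible P E \<eta> p y"
      using z(1) \<eta>_pos P_pos by (auto simp: feasible_def field_simps)
    then show ?case by (rule sg(3))
  qed
  moreover have "\<forall>\<^sub>F y in at e within {0..E}. Q p y \<le> Q p e + p / \<eta> * (y - e)"
    using sg(2) by (simp add: eventually_at_filter)
  ultimately show ?thesis
    by (rule has_real_derivative_squeeze[where \<phi> = ?\<phi> and F = "Q p", OF \<phi> eq])
qed

text \<open>Dually, the slope \<open>(p - c) * \<eta>\<close> annihilates
  \<open>p - c - \<sigma> / \<eta>\<close>, so the amount discharged is free. The positive price
  makes discharging feasible.\<close>

lemma discharge_supergradient:
  assumes p: "p > 0"
    and z: "z \<in> {0..E}" "\<forall>x\<in>{0..E}. W x \<le> W z + (p - c) * \<eta> * (x - z)"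
    and e: "e \<in> {0..E}" "z \<le> e" "e - P / \<eta> \<le> z"
  shows "Q p e = p * ((e - z) * \<eta> - 0) - c * ((e - z) * \<eta>) + W z"
    and "y \<in> {0..E} \<Longrightarrow> Q p y \<le> Q p e + (p - c) * \<eta> * (y - e)"
    and "(pc, pd, e') \<in> feasible P E \<eta> p y \<Longrightarrow> p * (pd - pc) - c * pd + W e' \<le> Q p y"
proof -
  have feas: "(0, (e - z) * \<eta>, z) \<in> feasible P E \<eta> p e"
    using z(1) e p \<eta>_pos P_pos by (auto simp: feasible_def field_simps)
  have opt: "optimal_controls ((p - c) * \<eta>) p 0 ((e - z) * \<eta>)"
    using no_charge_when_discharging[OF _ p, of _ "(p - c) * \<eta>"] \<eta>_pos
    by (simp add: optimal_controls_def)
  note sg = Q_supergradient[OF z(2) feas opt e(1)]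
  show "Q p e = p * ((e - z) * \<eta> - 0) - c * ((e - z) * \<eta>) + W z"
    and "y \<in> {0..E} \<Longrightarrow> Q p y \<le> Q p e + (p - c) * \<eta> * (y - e)"
    and "(pc, pd, e') \<in> feasible P E \<eta> p y \<Longrightarrow> p * (pd - pc) - c * pd + W e' \<le> Q p y"
    by (rule sg; assumption)+
qed

text \<open>The discharge \<open>(y - z) * \<eta>\<close> keeps the target \<open>z\<close>; the
  weak boundary cases are \<open>z = 0\<close> and departure from \<open>e = E\<close> at full
  power.\<close>

lemma Q_deriv_discharge:
  assumes p: "p > 0"
    and z: "z \<in> {0..E}" "\<forall>x\<in>{0..E}. W x \<le> W z + (p - c) * \<eta> * (x - z)"
    and e: "e \<in> {0..E}" "z < e \<or> z = 0" "e - P / \<eta> < z \<or> e = E \<and> z = e - P / \<eta>"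
  shows "(Q p has_real_derivative (p - c) * \<eta>) (at e within {0..E})"
proof -
  have "z \<le> e" "e - P / \<eta> \<le> z" using e by auto
  note sg = discharge_supergradient[OF p z e(1) this]
  let ?\<phi> = "\<lambda>y. p * ((y - z) * \<eta> - 0) - c * ((y - z) * \<eta>) + W z"
  have eq: "?\<phi> e = Q p e"
    by (simp add: sg(1))
  have \<phi>: "(?\<phi> has_real_derivative (p - c) * \<eta>) (at e within {0..E})"
    by (auto intro!: derivative_eq_intros simp: algebra_simps)
  have "\<forall>\<^sub>F y in at e within {0..E}. z \<le> y"
    using e unfolding eventually_at_topological
    by (intro exI[of _ "if z < e then {z<..} else UNIV"]) auto
  moreover have "\<forall>\<^sub>F y in at e within {0..E}. y - P / \<eta> \<le> z"
    using e unfolding eventually_at_topological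
    by (intro exI[of _ "if e = E \<and> z = e - P / \<eta> then UNIV else {..<z + P / \<eta>}"]) auto
  ultimately have "\<forall>\<^sub>F y in at e within {0..E}. ?\<phi> y \<le> Q p y"
  proof eventually_elim
    case (elim y)
    then have "(0, (y - z) * \<eta>, z) \<in> feasible P E \<eta> p y"
      using z(1) \<eta>_pos P_pos p by (auto simp: feasible_def field_simps)
    then show ?case by (rule sg(3))
  qed
  moreover have "\<forall>\<^sub>F y in at e within {0..E}. Q p y \<le> Q p e + (p - c) * \<eta> * (y - e)"
    using sg(2) by (simp add: eventually_at_filter)
  ultimately show ?thesis
    by (rule has_real_derivative_squeeze[where \<phi> = ?\<phi> and F = "Q p", OF \<phi> eq])
qed

text \<open>Difference quotients from both sides pin the slope at an interior state. The use is
  contrapositive: two distinct supergradients exhibit a kink.\<close>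

lemma supergradient_unique:
  assumes "Q p differentiable (at e within {0..E})" and e: "0 < e" "e < E"
    and s: "\<And>y. y \<in> {0..E} \<Longrightarrow> Q p y \<le> Q p e + s * (y - e)"
    and s': "\<And>y. y \<in> {0..E} \<Longrightarrow> Q p y \<le> Q p e + s' * (y - e)"
  shows "s = s'"
proof -
  obtain d where d: "(Q p has_real_derivative d) (at e within {0..E})"
    using assms(1) by (auto simp: real_differentiable_def)
  have "e \<in> {0..E}" using e by simp
  note * = derivative_vs_supergradient[OF d this]
  have "s \<le> d" "d \<le> s" using *[OF s] e by blast+
  moreover have "s' \<le> d" "d \<le> s'" using *[OF s'] e by blast+
  ultimately show ?thesis by simp
qed

section \<open>Derivative or kink in each of the five price ranges\<close>

lemma full_charge_optimal:
  assumes p: "p < w z * \<eta>"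
  shows "optimal_controls (w z) p P 0"
  unfolding optimal_controls_def
proof (intro ballI impI)
  fix pc pd assume *: "pc \<in> {0..P}" "pd \<in> {0..P}" "pd > 0 \<longrightarrow> p > 0"
  have "pd * (p - c - w z / \<eta>) \<le> 0"
    using no_discharge_when_charging[of pd p "w z"] p * by simp
  moreover have "pc * (w z * \<eta> - p) \<le> P * (w z * \<eta> - p)"
    using p * by (intro mult_right_mono) auto
  ultimately show "pd * (p - c - w z / \<eta>) + pc * (w z * \<eta> - p) \<le>
      0 * (p - c - w z / \<eta>) + P * (w z * \<eta> - p)"
    unfolding mult_zero_left by (rule add_mono)
qed

lemma full_charge_feasible: "e \<in> {0..E} \<Longrightarrow> e + P * \<eta> \<le> E \<Longrightarrow> (P, 0, e + P * \<eta>) \<in> feasible P E \<eta> p e"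
  using P_pos mult_pos_pos[OF P_pos \<eta>_pos] by (auto simp: feasible_def)

lemma Q_deriv_full_charge:
  assumes e: "e \<in> {0..E}" "e + P * \<eta> < E" and p: "p < w (e + P * \<eta>) * \<eta>"
  shows "(Q p has_real_derivative w (e + P * \<eta>)) (at e within {0..E})"
proof (rule Q_deriv_fixed_controls)
  show "(P, 0, e + P * \<eta>) \<in> feasible P E \<eta> p e"
    using full_charge_feasible e by simp
  have "0 < P * \<eta>" using P_pos \<eta>_pos by simp
  then show "e + P * \<eta> = e \<or> 0 < e + P * \<eta> \<and> e + P * \<eta> < E" using e by auto
qed (rule e full_charge_optimal[OF p])+

text \<open>At the upper end only displacements \<open>x - E \<le> 0\<close> occur, so every slope
  below \<open>w E\<close> is a supergradient as well.\<close>

lemma charge_to_full: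
  assumes "p < w E * \<eta>"
  shows "\<forall>x\<in>{0..E}. W x \<le> W E + p / \<eta> * (x - E)"
proof
  fix x assume x: "x \<in> {0..E}"
  have "p / \<eta> \<le> w E" using assms \<eta>_pos by (simp add: field_simps)
  then have "w E * (x - E) \<le> p / \<eta> * (x - E)"
    using x by (intro mult_right_mono_neg) auto
  then show "W x \<le> W E + p / \<eta> * (x - E)"
    using bspec[OF tangent[of E] x] E_pos by simp
qed

text \<open>Full power ends exactly at \<open>E\<close>: keeping the power gives the supergradient
  \<open>w E\<close>, keeping the full target gives \<open>p / \<eta>\<close>, and they differ
  because \<open>p < w E * \<eta>\<close>.\<close>

lemma Q_not_differentiable_charge:
  assumes e: "0 < e" "e < E" "e + P * \<eta> = E" and p: "p < w E * \<eta>"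
  shows "\<not> Q p differentiable (at e within {0..E})"
proof
  assume D: "Q p differentiable (at e within {0..E})"
  have e0: "e \<in> {0..E}" "E \<in> {0..E}" using e by auto
  have feas: "(P, 0, E) \<in> feasible P E \<eta> p e"
    using full_charge_feasible[OF e0(1)] e by simp
  note s = Q_supergradient(2)[OF tangent[OF e0(2)] feas full_charge_optimal[OF p] e0(1)]
  have "e \<le> E" "E \<le> e + P * \<eta>" using e by auto
  note s' = charge_supergradient(2)[OF e0(2) charge_to_full[OF p] e0(1) this]
  have "w E = p / \<eta>"
    by (rule supergradient_unique[OF D e(1,2) s s'])
  then show False using p \<eta>_pos by simp
qed

text \<open>From the empty state only increases of the state occur, and then less charging still
  reaches \<open>E\<close>; the one-sided slope is therefore \<open>p / \<eta>\<close> and not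
  \<open>w E\<close>.\<close>

lemma Q_deriv_charge_from_empty:
  assumes "P * \<eta> = E" and "p < w E * \<eta>"
  shows "(Q p has_real_derivative p / \<eta>) (at 0 within {0..E})"
proof (rule Q_deriv_charge[OF _ charge_to_full[OF assms(2)]])
  show "E < 0 + P * \<eta> \<or> 0 = (0::real) \<and> E = 0 + P * \<eta>"
    unfolding assms(1) by simp
qed (use E_pos in simp_all)

text \<open>The target is a point where \<open>p / \<eta>\<close> is a supergradient of
  \<open>W\<close>. Monotonicity of \<open>w\<close> and the two price bounds place it above
  \<open>e\<close>, unless it is \<open>E\<close>, and strictly below
  \<open>e + P * \<eta>\<close>.\<close>

lemma Q_deriv_partial_charge:
  assumes e: "e \<in> {0..E}" and p: "p < w e * \<eta>"
    and full: "e + P * \<eta> \<le> E \<Longrightarrow> w (e + P * \<eta>) * \<eta> < p"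
  shows "(Q p has_real_derivative p / \<eta>) (at e within {0..E})"
proof -
  obtain z where z: "z \<in> {0..E}" "\<forall>x\<in>{0..E}. W x \<le> W z + p / \<eta> * (x - z)"
    using ex_target by blast
  have P\<eta>: "0 < P * \<eta>" using P_pos \<eta>_pos by simp
  have pe: "p / \<eta> < w e" using p \<eta>_pos by (simp add: field_simps)
  note opt = derivative_vs_supergradient[OF w_deriv[OF z(1)] z(1), of "p / \<eta>"]
  have le: "z < E \<Longrightarrow> w z \<le> p / \<eta>" using opt(2) z(2) by blast
  have ge: "0 < z \<Longrightarrow> p / \<eta> \<le> w z" using opt(1) z(2) by blast
  have 1: "e < z \<or> z = E"
    using pe le w_antimono[OF z(1) e] z(1) by fastforce
  have 2: "z < e + P * \<eta>"
  proof (rule ccontr)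
    assume *: "\<not> z < e + P * \<eta>"
    then have "w (e + P * \<eta>) < p / \<eta>"
      using full z(1) \<eta>_pos by (simp add: field_simps)
    moreover have "w z \<le> w (e + P * \<eta>)"
      using * z(1) e P\<eta> by (intro w_antimono) auto
    moreover have "0 < z" using * e P\<eta> by auto
    ultimately show False using ge by simp
  qed
  show ?thesis using Q_deriv_charge[OF z e 1] 2 by simp
qed

text \<open>Charging has a negative margin, and discharging either has a negative margin or is
  forbidden by a nonpositive price.\<close>

lemma Q_deriv_idle:
  assumes e: "e \<in> {0..E}" and p: "w e * \<eta> < p" and "p \<le> 0 \<or> p < w e / \<eta> + c"
  shows "(Q p has_real_derivative w e) (at e within {0..E})"
proof (rule Q_deriv_fixed_controls)
  show "(0, 0, e) \<in> feasible P E \<eta> p e"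
    using e P_pos by (simp add: feasible_def)
  have "pd * (p - c - w e / \<eta>) + pc * (w e * \<eta> - p) \<le> 0"
    if "0 \<le> pc" "0 \<le> pd" and imp: "pd > 0 \<longrightarrow> p > 0" for pc pd
  proof -
    have "pd * (p - c - w e / \<eta>) \<le> 0"
    proof (cases "pd > 0")
      case True
      then have "p < w e / \<eta> + c" using imp assms(3) by simp
      then show ?thesis using True by (simp add: mult_le_0_iff)
    qed (use \<open>0 \<le> pd\<close> in simp)
    moreover have "pc * (w e * \<eta> - p) \<le> 0"
      using p \<open>0 \<le> pc\<close> by (simp add: mult_le_0_iff)
    ultimately show ?thesis by simp
  qed
  then show "optimal_controls (w e) p 0 0" by (simp add: optimal_controls_def)
qed (use e in auto)

lemma full_discharge_optimal:
  assumes p: "w z / \<eta> + c < p" "0 < p"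
  shows "optimal_controls (w z) p 0 P"
  unfolding optimal_controls_def
proof (intro ballI impI)
  fix pc pd assume *: "pc \<in> {0..P}" "pd \<in> {0..P}"
  have "w z \<le> (p - c) * \<eta>" using p(1) \<eta>_pos by (simp add: field_simps)
  then have "pc * (w z * \<eta> - p) \<le> 0"
    using no_charge_when_discharging[of pc p "w z"] p * by simp
  moreover have "pd * (p - c - w z / \<eta>) \<le> P * (p - c - w z / \<eta>)"
    using p * by (intro mult_right_mono) auto
  ultimately show "pd * (p - c - w z / \<eta>) + pc * (w z * \<eta> - p) \<le>
      P * (p - c - w z / \<eta>) + 0 * (w z * \<eta> - p)"
    unfolding mult_zero_left by (intro add_mono)
qed

lemma full_discharge_feasible:
  "e \<in> {0..E} \<Longrightarrow> 0 \<le> e - P / \<eta> \<Longrightarrow> 0 < p \<Longrightarrow> (0, P, e - P / \<eta>) \<in> feasible P E \<eta> p e"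
  using P_pos divide_pos_pos[OF P_pos \<eta>_pos] by (auto simp: feasible_def)

lemma Q_deriv_full_discharge:
  assumes e: "e \<in> {0..E}" "0 < e - P / \<eta>" and p: "w (e - P / \<eta>) / \<eta> + c < p" "0 < p"
  shows "(Q p has_real_derivative w (e - P / \<eta>)) (at e within {0..E})"
proof (rule Q_deriv_fixed_controls)
  show "(0, P, e - P / \<eta>) \<in> feasible P E \<eta> p e"
    using full_discharge_feasible e p by simp
  have "0 < P / \<eta>" using P_pos \<eta>_pos by simp
  then show "e - P / \<eta> = e \<or> 0 < e - P / \<eta> \<and> e - P / \<eta> < E" using e by auto
qed (rule e full_discharge_optimal[OF p])+

text \<open>At the lower end \<open>x - 0 \<ge> 0\<close>, so slopes above \<open>w 0\<close> are
  supergradients too.\<close>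

lemma discharge_to_empty:
  assumes "w 0 / \<eta> + c < p"
  shows "\<forall>x\<in>{0..E}. W x \<le> W 0 + (p - c) * \<eta> * (x - 0)"
proof
  fix x assume x: "x \<in> {0..E}"
  have "w 0 \<le> (p - c) * \<eta>" using assms \<eta>_pos by (simp add: field_simps)
  then have "w 0 * (x - 0) \<le> (p - c) * \<eta> * (x - 0)"
    using x by (intro mult_right_mono) auto
  then show "W x \<le> W 0 + (p - c) * \<eta> * (x - 0)"
    using bspec[OF tangent[of 0] x] E_pos by simp
qed

text \<open>Mirror image of the charging kink: keeping full power gives \<open>w 0\<close>, keeping
  the empty target gives \<open>(p - c) * \<eta>\<close>.\<close>

lemma Q_not_differentiable_discharge:
  assumes e: "0 < e" "e < E" "e - P / \<eta> = 0" and p: "w 0 / \<eta> + c < p" "0 < p"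
  shows "\<not> Q p differentiable (at e within {0..E})"
proof
  assume D: "Q p differentiable (at e within {0..E})"
  have e0: "e \<in> {0..E}" "0 \<in> {0..E}" using e by auto
  have feas: "(0, P, 0) \<in> feasible P E \<eta> p e"
    using full_discharge_feasible[OF e0(1) _ p(2)] e by simp
  note s = Q_supergradient(2)[OF tangent[OF e0(2)] feas full_discharge_optimal[OF p] e0(1)]
  have "0 \<le> e" "e - P / \<eta> \<le> 0" using e by auto
  note s' = discharge_supergradient(2)[OF p(2) e0(2) discharge_to_empty[OF p(1)] e0(1) this]
  have "w 0 = (p - c) * \<eta>"
    by (rule supergradient_unique[OF D e(1,2) s s'])
  then show False using p \<eta>_pos by simp
qed

text \<open>Nearby states are lower and need less than full power to empty the storage, so the
  one-sided slope follows the price.\<close>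

lemma Q_deriv_discharge_from_full:
  assumes "P / \<eta> = E" and "w 0 / \<eta> + c < p" "0 < p"
  shows "(Q p has_real_derivative (p - c) * \<eta>) (at E within {0..E})"
proof (rule Q_deriv_discharge[OF assms(3) _ discharge_to_empty[OF assms(2)]])
  show "E - P / \<eta> < 0 \<or> E = E \<and> 0 = E - P / \<eta>"
    unfolding assms(1) by simp
qed (use E_pos in simp_all)

text \<open>Localisation as for partial charging, now with slope \<open>(p - c) * \<eta>\<close>:
  the target lies below \<open>e\<close>, unless it is \<open>0\<close>, and strictly above
  \<open>e - P / \<eta>\<close>.\<close>

lemma Q_deriv_partial_discharge:
  assumes e: "e \<in> {0..E}" and p: "0 < p" "w e / \<eta> + c < p"
    and full: "0 \<le> e - P / \<eta> \<Longrightarrow> p < w (e - P / \<eta>) / \<eta> + c"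
  shows "(Q p has_real_derivative (p - c) * \<eta>) (at e within {0..E})"
proof -
  obtain z where z: "z \<in> {0..E}" "\<forall>x\<in>{0..E}. W x \<le> W z + (p - c) * \<eta> * (x - z)"
    using ex_target by blast
  have P\<eta>: "0 < P / \<eta>" using P_pos \<eta>_pos by simp
  have pe: "w e < (p - c) * \<eta>" using p \<eta>_pos by (simp add: field_simps)
  note opt = derivative_vs_supergradient[OF w_deriv[OF z(1)] z(1), of "(p - c) * \<eta>"]
  have le: "z < E \<Longrightarrow> w z \<le> (p - c) * \<eta>" using opt(2) z(2) by blast
  have ge: "0 < z \<Longrightarrow> (p - c) * \<eta> \<le> w z" using opt(1) z(2) by blast
  have 1: "z < e \<or> z = 0"
    using pe ge w_antimono[OF e z(1)] z(1) by fastforce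
  have 2: "e - P / \<eta> < z"
  proof (rule ccontr)
    assume *: "\<not> e - P / \<eta> < z"
    then have "p < w (e - P / \<eta>) / \<eta> + c"
      using full z(1) by simp
    then have "(p - c) * \<eta> < w (e - P / \<eta>)"
      using \<eta>_pos by (simp add: field_simps)
    moreover have "w (e - P / \<eta>) \<le> w z"
      using * z(1) e P\<eta> by (intro w_antimono) auto
    moreover have "z < E" using * e P\<eta> by auto
    ultimately show False using le by simp
  qed
  show ?thesis using Q_deriv_discharge[OF p(1) z e 1] 2 by simp
qed

section \<open>The marginal value as a function of the price\<close>

abbreviation v :: "real \<Rightarrow> ereal" where
  "v \<equiv> value_deriv E W"

abbreviation q :: "real \<Rightarrow> real \<Rightarrow> real" where
  "q \<equiv> qval P E \<eta> c W"

abbreviation charge_bound :: "real \<Rightarrow> ereal" where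
  "charge_bound z \<equiv> v z * ereal \<eta>"

text \<open>Selling pays above \<open>v z / \<eta> + c\<close>, but is permitted only at positive
  prices; the positive part merges the two conditions.\<close>

abbreviation discharge_bound :: "real \<Rightarrow> ereal" where
  "discharge_bound z \<equiv> pos_part (v z / ereal \<eta> + ereal c)"

lemma v_eq: "z \<in> {0..E} \<Longrightarrow> v z = ereal (w z)"
  by (simp add: value_deriv_def w_def)

lemma v_antimono: "x \<le> y \<Longrightarrow> v y \<le> v x"
  using w_antimono[of x y] by (auto simp: value_deriv_def w_def)

lemma bounds_real:
  assumes "z \<in> {0..E}"
  shows "charge_bound z = ereal (w z * \<eta>)"
    and "discharge_bound z = ereal (max (w z / \<eta> + c) 0)"
  using assms \<eta>_pos by (auto simp: v_eq pos_part_def zero_ereal_def max_def)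

lemma charge_bound_above: "E < z \<Longrightarrow> charge_bound z = - \<infinity>"
  using \<eta>_pos E_pos by (simp add: value_deriv_def)

lemma discharge_bound_below: "z < 0 \<Longrightarrow> discharge_bound z = \<infinity>"
  using \<eta>_pos by (simp add: value_deriv_def pos_part_def divide_ereal_def max_def)

lemma charge_bound_le: "x \<le> y \<Longrightarrow> charge_bound y \<le> charge_bound x"
  using \<eta>_pos v_antimono by (intro ereal_mult_right_mono) auto

lemma discharge_bound_le: "x \<le> y \<Longrightarrow> discharge_bound y \<le> discharge_bound x"
  unfolding pos_part_def using \<eta>_pos v_antimono[of x y]
  by (intro max.mono add_right_mono ereal_divide_right_mono) auto

text \<open>For \<open>w z \<ge> 0\<close> this is \<open>\<eta> \<le> 1 / \<eta>\<close>, and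
  \<open>c\<close> only adds; for negative \<open>w z\<close> the left side is negative and lies
  below the truncation at \<open>0\<close>.\<close>

lemma charge_bound_le_discharge_bound:
  assumes "z \<in> {0..E}"
  shows "charge_bound z \<le> discharge_bound z"
proof -
  have "w z * \<eta> \<le> max (w z / \<eta> + c) 0"
  proof (cases "w z \<ge> 0")
    case True
    have "w z * (\<eta> * \<eta>) \<le> w z * 1"
      using True \<eta>_pos \<eta>_le_1 by (intro mult_left_mono mult_le_one) auto
    then have "w z * \<eta> \<le> w z / \<eta>" using \<eta>_pos by (simp add: field_simps)
    then show ?thesis using c_pos by simp
  next
    case False
    then show ?thesis using \<eta>_pos by (simp add: mult_nonpos_nonneg max.coboundedI2)
  qed
  then show ?thesis using bounds_real[OF assms] by (auto simp: le_max_iff_disj)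
qed

section \<open>Marginal value on each price range\<close>

lemma q_eqI:
  assumes "(Q p has_real_derivative s) (at e within {0..E})" "e \<in> {0..E}"
  shows "q p e = s"
  using assms E_pos vector_derivative_within_closed_interval[of 0 E e "Q p" s]
  by (simp add: qval_def has_real_derivative_iff_has_vector_derivative)

lemma q_partial_charge:
  assumes e: "e \<in> {0..E}" and p: "charge_bound (e + P * \<eta>) < ereal p" "ereal p < charge_bound e"
  shows "q p e = p / \<eta>"
proof (rule q_eqI[OF Q_deriv_partial_charge])
  assume "e + P * \<eta> \<le> E"
  moreover have "0 \<le> P * \<eta>" using P_pos \<eta>_pos by simp
  ultimately show "w (e + P * \<eta>) * \<eta> < p"
    using p(1) e bounds_real[of "e + P * \<eta>"] by simp
qed (use p e bounds_real in auto)

lemma q_idle: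
  assumes e: "e \<in> {0..E}" and p: "charge_bound e < ereal p" "ereal p < discharge_bound e"
  shows "q p e = w e"
  using p e bounds_real[OF e] by (intro q_eqI[OF Q_deriv_idle]) (auto simp: less_max_iff_disj)

lemma q_partial_discharge:
  assumes e: "e \<in> {0..E}" and p: "discharge_bound e < ereal p" "ereal p < discharge_bound (e - P / \<eta>)"
  shows "q p e = (p - c) * \<eta>"
proof -
  have p': "0 < p" "w e / \<eta> + c < p"
    using p e bounds_real[OF e] by auto
  show ?thesis
  proof (rule q_eqI[OF Q_deriv_partial_discharge[OF e p'] e])
    assume "0 \<le> e - P / \<eta>"
    moreover have "0 \<le> P / \<eta>" using P_pos \<eta>_pos by simp
    ultimately show "p < w (e - P / \<eta>) / \<eta> + c"
      using p(2) p' e bounds_real[of "e - P / \<eta>"] by (auto simp: max_def split: if_splits)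
  qed
qed

lemma full_charge_cases:
  assumes e: "e \<in> {0..E}" and p: "ereal p < charge_bound (e + P * \<eta>)"
  shows "e < E" "e + P * \<eta> \<in> {0..E}" "p < w (e + P * \<eta>) * \<eta>"
proof -
  have "0 < P * \<eta>" using P_pos \<eta>_pos by simp
  moreover have "e + P * \<eta> \<le> E"
    using p charge_bound_above[of "e + P * \<eta>"] by force
  ultimately show "e < E" "e + P * \<eta> \<in> {0..E}" using e by auto
  then show "p < w (e + P * \<eta>) * \<eta>" using p bounds_real by simp
qed

lemma full_discharge_cases:
  assumes e: "e \<in> {0..E}" and p: "discharge_bound (e - P / \<eta>) < ereal p"
  shows "0 < e" "e - P / \<eta> \<in> {0..E}" "w (e - P / \<eta>) / \<eta> + c < p" "0 < p"
proof -
  have "0 < P / \<eta>" using P_pos \<eta>_pos by simp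
  moreover have "0 \<le> e - P / \<eta>"
    using p discharge_bound_below[of "e - P / \<eta>"] by force
  ultimately show "0 < e" "e - P / \<eta> \<in> {0..E}" using e by auto
  then show "w (e - P / \<eta>) / \<eta> + c < p" "0 < p" using p bounds_real by auto
qed

text \<open>A full charge that exactly reaches \<open>E\<close> produces a kink at an interior
  state, contradicting differentiability; from the empty state it is excluded by the last
  assumption. So the target lies strictly below \<open>E\<close>.\<close>

lemma q_full_charge:
  assumes e: "e \<in> {0..E}" and p: "ereal p < charge_bound (e + P * \<eta>)"
    and "Q p differentiable (at e within {0..E})" and "\<not> (e = 0 \<and> P * \<eta> = E)"
  shows "q p e = w (e + P * \<eta>)"
proof -
  note r = full_charge_cases[OF e p]
  have "e + P * \<eta> \<noteq> E"
    using Q_not_differentiable_charge[of e p] assms(3,4) r e by force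
  then show ?thesis
    using r e by (intro q_eqI[OF Q_deriv_full_charge]) auto
qed

lemma q_full_discharge:
  assumes e: "e \<in> {0..E}" and p: "discharge_bound (e - P / \<eta>) < ereal p"
    and "Q p differentiable (at e within {0..E})" and "\<not> (e = E \<and> P / \<eta> = E)"
  shows "q p e = w (e - P / \<eta>)"
proof -
  note r = full_discharge_cases[OF e p]
  have "e - P / \<eta> \<noteq> 0"
    using Q_not_differentiable_discharge[of e p] assms(3,4) r e by force
  then show ?thesis
    using r e by (intro q_eqI[OF Q_deriv_full_discharge]) auto
qed

text \<open>Measurability concerns all prices, including those without differentiability. On this
  range the marginal value is the constant slope, the constant default at a kink, or linear in the
  price, according to whether and from where full power exactly reaches \<open>E\<close>.\<close>

lemma q_full_charge_measurable:
  assumes e: "e \<in> {0..E}"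
  obtains h where "h \<in> borel_measurable borel"
    and "\<And>p. ereal p < charge_bound (e + P * \<eta>) \<Longrightarrow> q p e = h p"
proof -
  consider "e + P * \<eta> \<noteq> E" | "e + P * \<eta> = E" "e \<noteq> 0" | "e + P * \<eta> = E" "e = 0" by blast
  then show ?thesis
  proof cases
    case 1
    have "q p e = w (e + P * \<eta>)" if "ereal p < charge_bound (e + P * \<eta>)" for p
      using 1 full_charge_cases[OF e that] e by (intro q_eqI[OF Q_deriv_full_charge]) auto
    then show ?thesis using that[of "\<lambda>_. w (e + P * \<eta>)"] by simp
  next
    case 2
    have "q p e = (SOME d. False)" if "ereal p < charge_bound (e + P * \<eta>)" for p
      unfolding qval_def using 2 full_charge_cases[OF e that] e
      by (intro vector_derivative_not_differentiable Q_not_differentiable_charge) auto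
    then show ?thesis using that[of "\<lambda>_. SOME d. False"] by simp
  next
    case 3
    have "q p e = p / \<eta>" if "ereal p < charge_bound (e + P * \<eta>)" for p
      using 3 full_charge_cases[OF e that] e Q_deriv_charge_from_empty[of p]
      by (intro q_eqI) auto
    then show ?thesis using that[of "\<lambda>p. p / \<eta>"] by simp
  qed
qed

lemma q_full_discharge_measurable:
  assumes e: "e \<in> {0..E}"
  obtains h where "h \<in> borel_measurable borel"
    and "\<And>p. discharge_bound (e - P / \<eta>) < ereal p \<Longrightarrow> q p e = h p"
proof -
  consider "e - P / \<eta> \<noteq> 0" | "e - P / \<eta> = 0" "e \<noteq> E" | "e - P / \<eta> = 0" "e = E" by blast
  then show ?thesis
  proof cases
    case 1
    have "q p e = w (e - P / \<eta>)" if "discharge_bound (e - P / \<eta>) < ereal p" for p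
      using 1 full_discharge_cases[OF e that] e by (intro q_eqI[OF Q_deriv_full_discharge]) auto
    then show ?thesis using that[of "\<lambda>_. w (e - P / \<eta>)"] by simp
  next
    case 2
    have "q p e = (SOME d. False)" if "discharge_bound (e - P / \<eta>) < ereal p" for p
      unfolding qval_def using 2 full_discharge_cases[OF e that] e
      by (intro vector_derivative_not_differentiable Q_not_differentiable_discharge) auto
    then show ?thesis using that[of "\<lambda>_. SOME d. False"] by simp
  next
    case 3
    have "q p e = (p - c) * \<eta>" if "discharge_bound (e - P / \<eta>) < ereal p" for p
      using 3 full_discharge_cases[OF e that] e Q_deriv_discharge_from_full[of p]
      by (intro q_eqI) auto
    then show ?thesis using that[of "\<lambda>p. (p - c) * \<eta>"] by simp
  qed
qed

section \<open>Thresholds and the piecewise affine form of the marginal value\<close>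

definition thresholds :: "real \<Rightarrow> real set" where
  "thresholds e = {p. ereal p \<in> {charge_bound (e + P * \<eta>), charge_bound e,
    discharge_bound e, discharge_bound (e - P / \<eta>)}}"

text \<open>The set is the preimage of at most four extended reals under the injective
  \<open>ereal\<close>; infinite bounds contribute no price.\<close>

lemma finite_thresholds: "finite (thresholds e)"
  unfolding thresholds_def Collect_mem_eq[symmetric]
  by (rule finite_vimageI[of _ ereal, unfolded vimage_def]) (auto simp: inj_on_def)

lemma q_measurable:
  assumes e: "e \<in> {0..E}"
  shows "(\<lambda>p. q p e) \<in> borel_measurable borel"
proof -
  obtain h where h [measurable]: "h \<in> borel_measurable borel"
    and qh: "\<And>p. ereal p < charge_bound (e + P * \<eta>) \<Longrightarrow> q p e = h p"
    using q_full_charge_measurable[OF e] by blast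
  obtain k where k [measurable]: "k \<in> borel_measurable borel"
    and qk: "\<And>p. discharge_bound (e - P / \<eta>) < ereal p \<Longrightarrow> q p e = k p"
    using q_full_discharge_measurable[OF e] by blast
  \<comment> \<open>The values of \<open>?r\<close> on the finite set \<open>thresholds e\<close>
    are arbitrary; off it, each failed comparison is strict in the other direction.\<close>
  let ?r = "\<lambda>p. if ereal p < charge_bound (e + P * \<eta>) then h p
    else if ereal p < charge_bound e then p / \<eta>
    else if ereal p < discharge_bound e then w e
    else if ereal p < discharge_bound (e - P / \<eta>) then (p - c) * \<eta> else k p"
  show ?thesis
  proof (rule measurable_discrete_difference)
    show "?r \<in> borel_measurable borel" by measurable
    show "countable (thresholds e)" using finite_thresholds by (rule countable_finite)
    show "?r p = q p e" if "p \<in> space borel" "p \<notin> thresholds e" for p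
      using that qh qk q_partial_charge[OF e, of p] q_idle[OF e, of p] q_partial_discharge[OF e, of p]
      by (auto simp: thresholds_def not_less le_less)
  qed auto
qed

text \<open>Every piece has the shape \<open>(k * p + m) * indicator\<close>, so that one
  integration lemma serves all five. \<open>real_of_ereal\<close> sends an infinite slope to
  \<open>0\<close>, and the interval of such a slope is empty.\<close>

definition q_pieces :: "real \<Rightarrow> real \<Rightarrow> real" where
  "q_pieces p e =
    (0 * p + real_of_ereal (v (e + P * \<eta>))) * indicator (einterval (- \<infinity>) (charge_bound (e + P * \<eta>))) p
    + (1 / \<eta> * p + 0) * indicator (einterval (charge_bound (e + P * \<eta>)) (charge_bound e)) p
    + (0 * p + w e) * indicator (einterval (charge_bound e) (discharge_bound e)) p
    + (\<eta> * p + (- c * \<eta>)) * indicator (einterval (discharge_bound e) (discharge_bound (e - P / \<eta>))) p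
    + (0 * p + real_of_ereal (v (e - P / \<eta>))) * indicator (einterval (discharge_bound (e - P / \<eta>)) \<infinity>) p"

lemma thresholds_ordered:
  assumes e: "e \<in> {0..E}"
  shows "charge_bound (e + P * \<eta>) \<le> charge_bound e"
    and "charge_bound e \<le> discharge_bound e"
    and "discharge_bound e \<le> discharge_bound (e - P / \<eta>)"
  using charge_bound_le[of e "e + P * \<eta>"] discharge_bound_le[of "e - P / \<eta>" e]
    charge_bound_le_discharge_bound[OF e] P_pos \<eta>_pos by auto

lemma q_eq_pieces:
  assumes e: "e \<in> {0..E}" and diff: "Q p differentiable (at e within {0..E})"
    and p: "p \<notin> thresholds e"
    and charge: "e = 0 \<Longrightarrow> P * \<eta> = E \<Longrightarrow> charge_bound E \<le> ereal p"
    and discharge: "e = E \<Longrightarrow> P / \<eta> = E \<Longrightarrow> ereal p \<le> discharge_bound 0"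
  shows "q p e = q_pieces p e"
proof -
  let ?a = "charge_bound (e + P * \<eta>)" and ?b = "charge_bound e"
    and ?c = "discharge_bound e" and ?d = "discharge_bound (e - P / \<eta>)"
  note ord = thresholds_ordered[OF e]
  have "ereal p \<noteq> ?a" "ereal p \<noteq> ?b" "ereal p \<noteq> ?c" "ereal p \<noteq> ?d"
    using p unfolding thresholds_def by blast+
  then consider "ereal p < ?a" | "?a < ereal p" "ereal p < ?b" | "?b < ereal p" "ereal p < ?c"
    | "?c < ereal p" "ereal p < ?d" | "?d < ereal p"
    by (meson linorder_neqE)
  then show ?thesis
  proof cases
    case 1
    \<comment> \<open>In the corner \<open>e = 0\<close>, \<open>P * \<eta> = E\<close> the
      hypothesis \<open>charge\<close> contradicts this price range.\<close>
    then have "q p e = w (e + P * \<eta>)"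
      using charge by (intro q_full_charge[OF e _ diff]) auto
    moreover have "v (e + P * \<eta>) = ereal (w (e + P * \<eta>))"
      using full_charge_cases(2)[OF e 1] by (rule v_eq)
    moreover have "\<not> ?a < ereal p" "\<not> ?b < ereal p" "\<not> ?c < ereal p" "\<not> ?d < ereal p"
      using 1 ord by (meson leD less_imp_le order_trans)+
    ultimately show ?thesis using 1 by (simp add: q_pieces_def einterval_def)
  next
    case 2
    then have "q p e = p / \<eta>" by (rule q_partial_charge[OF e])
    moreover have "\<not> ereal p < ?a" "\<not> ?b < ereal p" "\<not> ?c < ereal p" "\<not> ?d < ereal p"
      using 2 ord by (meson leD less_imp_le order_trans)+
    ultimately show ?thesis using 2 by (simp add: q_pieces_def einterval_def)
  next
    case 3
    then have "q p e = w e" by (rule q_idle[OF e])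
    moreover have "\<not> ereal p < ?a" "\<not> ereal p < ?b" "\<not> ?c < ereal p" "\<not> ?d < ereal p"
      using 3 ord by (meson leD less_imp_le order_trans)+
    ultimately show ?thesis using 3 by (simp add: q_pieces_def einterval_def)
  next
    case 4
    then have "q p e = (p - c) * \<eta>" by (rule q_partial_discharge[OF e])
    moreover have "\<not> ereal p < ?a" "\<not> ereal p < ?b" "\<not> ereal p < ?c" "\<not> ?d < ereal p"
      using 4 ord by (meson leD less_imp_le order_trans)+
    ultimately show ?thesis using 4 by (simp add: q_pieces_def einterval_def algebra_simps)
  next
    case 5
    then have "q p e = w (e - P / \<eta>)"
      using discharge by (intro q_full_discharge[OF e _ diff]) auto
    moreover have "v (e - P / \<eta>) = ereal (w (e - P / \<eta>))"
      using full_discharge_cases(2)[OF e 5] by (rule v_eq)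
    moreover have "\<not> ereal p < ?a" "\<not> ereal p < ?b" "\<not> ereal p < ?c" "\<not> ereal p < ?d"
      using 5 ord by (meson leD less_imp_le order_trans)+
    ultimately show ?thesis using 5 by (simp add: q_pieces_def einterval_def)
  qed
qed

end

section \<open>Integration over the price\<close>

text \<open>A density leaves no atoms, so \<open>cdf_ext\<close> measures the closed and the open
  ray alike, also at infinite end points; an open interval is a difference of two such rays.\<close>

lemma (in prob_space) cdf_ext_diff:
  fixes X :: "'a \<Rightarrow> real"
  assumes X: "distributed M lborel X f" and ab: "a \<le> b"
  shows "(\<integral>\<omega>. indicator (einterval a b) (X \<omega>) \<partial>M) =
    cdf_ext (distr M borel X) b - cdf_ext (distr M borel X) a"
proof -
  define D where "D = distr M borel X"
  have [measurable]: "X \<in> borel_measurable M"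
    using distributed_measurable[OF X] by simp
  interpret D: prob_space D
    unfolding D_def by (rule prob_space_distr) simp
  have [simp]: "sets D = sets borel" "space D = UNIV" by (simp_all add: D_def)
  have null: "measure D {x} = 0" for x
  proof -
    have "AE y in lborel. y \<noteq> x" by (rule AE_lborel_singleton)
    then have "AE \<omega> in M. X \<omega> \<noteq> x"
      by (subst distributed_AE2[OF X]) auto
    then have "AE y in D. y \<noteq> x"
      unfolding D_def by (subst AE_distr_iff) auto
    then show ?thesis
      by (subst D.prob_eq_0) auto
  qed
  have le: "cdf_ext D x = measure D {y. ereal y \<le> x}" for x
    using D.prob_space by (cases x) (auto simp: cdf_ext_def cdf_def atMost_def)
  have less: "cdf_ext D x = measure D {y. ereal y < x}" for x
  proof (cases x)
    case (real r)
    have "measure D {..r} = measure D ({..<r} \<union> {r})"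
      by (rule arg_cong[where f = "measure D"]) auto
    also have "\<dots> = measure D {..<r}"
      using null by (subst D.finite_measure_Union) auto
    finally show ?thesis
      using real by (simp add: cdf_ext_def cdf_def lessThan_def)
  qed (use D.prob_space in \<open>auto simp: cdf_ext_def\<close>)
  have "(\<integral>\<omega>. indicator (einterval a b) (X \<omega>) \<partial>M) = (\<integral>x. indicat_real (einterval a b) x \<partial>D)"
    unfolding D_def by (subst integral_distr) auto
  also have "\<dots> = measure D (einterval a b)" by simp
  also have "\<dots> = cdf_ext D b - cdf_ext D a"
  \<comment> \<open>Nesting of the two rays is guaranteed for \<open>a < b\<close>; for
    \<open>a = b\<close> the interval is empty and both sides vanish.\<close>
  proof (cases "a < b")
    case True
    have "measure D (einterval a b) = measure D ({y. ereal y < b} - {y. ereal y \<le> a})"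
      by (rule arg_cong[where f = "measure D"]) (auto simp: einterval_def)
    also have "\<dots> = measure D {y. ereal y < b} - measure D {y. ereal y \<le> a}"
      using True by (intro D.finite_measure_Diff) auto
    finally show ?thesis using less[of b] le[of a] by simp
  next
    case False
    then have "a = b" "einterval a b = {}" using ab by (auto simp: einterval_def)
    then show ?thesis by simp
  qed
  finally show ?thesis by (simp add: D_def)
qed

lemma (in prob_space) distributed_interval_integral:
  fixes X :: "'a \<Rightarrow> real" and f :: "real \<Rightarrow> real"
  assumes X: "distributed M lborel X (\<lambda>x. ennreal (f x))" and f: "\<And>x. 0 \<le> f x" and ab: "a \<le> b"
  shows "(\<integral>\<omega>. X \<omega> * indicator (einterval a b) (X \<omega>) \<partial>M) = (LBINT u=a..b. u * f u)"
proof -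
  have "(\<integral>\<omega>. X \<omega> * indicator (einterval a b) (X \<omega>) \<partial>M) =
      (\<integral>u. f u * (u * indicator (einterval a b) u) \<partial>lborel)"
    using f by (subst distributed_integral[OF X]) auto
  also have "\<dots> = (LBINT u=a..b. u * f u)"
    using ab unfolding interval_lebesgue_integral_def set_lebesgue_integral_def
    by (auto intro!: Bochner_Integration.integral_cong split: split_indicator)
  finally show ?thesis .
qed

text \<open>The integrable \<open>X\<close> dominates the linear part, and the constant part is
  bounded on a probability space, so infinite end points are allowed.\<close>

lemma (in prob_space) integral_linear_on_einterval:
  fixes X :: "'a \<Rightarrow> real" and f :: "real \<Rightarrow> real"
  assumes X: "distributed M lborel X (\<lambda>x. ennreal (f x))" and f: "\<And>x. 0 \<le> f x"
    and int: "integrable M X" and ab: "a \<le> b"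
  shows "integrable M (\<lambda>\<omega>. (k * X \<omega> + m) * indicator (einterval a b) (X \<omega>))" (is ?int)
    and "(\<integral>\<omega>. (k * X \<omega> + m) * indicator (einterval a b) (X \<omega>) \<partial>M) =
      k * (LBINT u=a..b. u * f u) + m * (cdf_ext (distr M borel X) b - cdf_ext (distr M borel X) a)"
      (is ?eq)
proof -
  have [measurable]: "X \<in> borel_measurable M"
    using distributed_measurable[OF X] by simp
  have i1: "integrable M (\<lambda>\<omega>. X \<omega> * indicator (einterval a b) (X \<omega>))"
    by (rule Bochner_Integration.integrable_bound[OF int]) (auto split: split_indicator)
  have i2: "integrable M (\<lambda>\<omega>. indicator (einterval a b) (X \<omega>) :: real)"
    by (rule integrable_const_bound[of _ 1]) (auto split: split_indicator)
  have split: "(k * X \<omega> + m) * indicator (einterval a b) (X \<omega>) =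
      k * (X \<omega> * indicator (einterval a b) (X \<omega>)) + m * indicator (einterval a b) (X \<omega>)" for \<omega>
    by (simp add: algebra_simps)
  show ?int unfolding split using i1 i2 by simp
  show ?eq
    unfolding split using i1 i2 distributed_interval_integral[OF X f ab] cdf_ext_diff[OF X ab]
    by simp
qed

theorem proposition5:
  fixes M :: "'a measure"
    and P E \<eta> c e :: real
    and T t :: nat
    and price :: "nat \<Rightarrow> 'a \<Rightarrow> real"
    and f :: "nat \<Rightarrow> real \<Rightarrow> real"
    and V :: "nat \<Rightarrow> real \<Rightarrow> real"
  assumes "prob_space M"
    and "P > 0" and "E > 0" and "0 < \<eta>" and "\<eta> \<le> 1" and "c > 0"
    and "prob_space.indep_vars M (\<lambda>_. borel) price {1..T}"
    and "\<And>s. s \<in> {1..T} \<Longrightarrow> integrable M (price s)"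
    and "\<And>s x. s \<in> {1..T} \<Longrightarrow> f s x \<ge> 0"
    and "\<And>s. s \<in> {1..T} \<Longrightarrow> distributed M lborel (price s) (\<lambda>x. ennreal (f s x))"
    and "\<And>s x. s \<in> {1..T} \<Longrightarrow> x \<in> {0..E} \<Longrightarrow>
           V (s - 1) x = (\<integral>\<omega>. Qval P E \<eta> c (V s) (price s \<omega>) x \<partial>M)"
    and "t \<in> {1..T}"
    and "concave_on {0..E} (V t)"
    and "V t differentiable_on {0..E}"
    and "e \<in> {0..E}"
    and "AE \<omega> in M. Qval P E \<eta> c (V t) (price t \<omega>) differentiable (at e within {0..E})"
    and corner_charge: "e = 0 \<Longrightarrow> P * \<eta> = E \<Longrightarrow>
           AE \<omega> in M. value_deriv E (V t) E * \<eta> \<le> price t \<omega>"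
    and corner_discharge: "e = E \<Longrightarrow> P / \<eta> = E \<Longrightarrow>
           AE \<omega> in M. price t \<omega> \<le> pos_part (value_deriv E (V t) 0 / \<eta> + c)"
  shows "integrable M (\<lambda>\<omega>. qval P E \<eta> c (V t) (price t \<omega>) e) \<and>
    (let v = value_deriv E (V t); F = cdf_ext (distr M borel (price t)) in
     ereal (\<integral>\<omega>. qval P E \<eta> c (V t) (price t \<omega>) e \<partial>M) =
       v (e + P * \<eta>) * F (v (e + P * \<eta>) * \<eta>)
       + 1 / \<eta> * (LBINT u = v (e + P * \<eta>) * \<eta>..v e * \<eta>. u * f t u)
       + v e * (F (pos_part (v e / \<eta> + c)) - F (v e * \<eta>))
       + \<eta> * (LBINT w = pos_part (v e / \<eta> + c)..pos_part (v (e - P / \<eta>) / \<eta> + c). w * f t w)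
       - c * \<eta> * (F (pos_part (v (e - P / \<eta>) / \<eta> + c)) - F (pos_part (v e / \<eta> + c)))
       + v (e - P / \<eta>) * (1 - F (pos_part (v (e - P / \<eta>) / \<eta> + c))))"
proof -
  interpret prob_space M by fact
  interpret storage_period P E \<eta> c "V t"
    using assms(2-6,13,14) by unfold_locales auto
  note e = \<open>e \<in> {0..E}\<close>
  let ?X = "price t" and ?F = "cdf_ext (distr M borel (price t))"
  let ?a = "charge_bound (e + P * \<eta>)" and ?b = "charge_bound e"
    and ?c = "discharge_bound e" and ?d = "discharge_bound (e - P / \<eta>)"
  have X: "distributed M lborel ?X (\<lambda>x. ennreal (f t x))" and f: "\<And>x. 0 \<le> f t x"
    and int: "integrable M ?X"
    using assms(8-10)[OF \<open>t \<in> {1..T}\<close>] by auto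
  have [measurable]: "?X \<in> borel_measurable M"
    using int by simp
  note ord = thresholds_ordered[OF e]
  have inf: "- \<infinity> \<le> ?a" "?d \<le> \<infinity>" by auto
  note piece = integral_linear_on_einterval[OF X f int]
  note pieces = piece[OF inf(1)] piece[OF ord(1)] piece[OF ord(2)] piece[OF ord(3)] piece[OF inf(2)]
  have [measurable]: "thresholds e \<in> sets borel"
    using finite_thresholds by (intro borel_closed finite_imp_closed)
  have "AE x in lborel. x \<notin> thresholds e"
    using finite_thresholds by (intro AE_not_in finite_imp_null_set_lborel)
  then have "AE \<omega> in M. ?X \<omega> \<notin> thresholds e"
    by (subst distributed_AE2[OF X]) auto
  \<comment> \<open>Written as implications, the corner hypotheses become almost sure facts for
    every \<open>e\<close> and combine with the others.\<close>
  moreover have "AE \<omega> in M. e = 0 \<longrightarrow> P * \<eta> = E \<longrightarrow> charge_bound E \<le> ereal (?X \<omega>)"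
    using corner_charge by (cases "e = 0 \<and> P * \<eta> = E") auto
  moreover have "AE \<omega> in M. e = E \<longrightarrow> P / \<eta> = E \<longrightarrow> ereal (?X \<omega>) \<le> discharge_bound 0"
    using corner_discharge by (cases "e = E \<and> P / \<eta> = E") auto
  ultimately have ae: "AE \<omega> in M. q_pieces (?X \<omega>) e = q (?X \<omega>) e"
    using assms(16)
  proof eventually_elim
    case (elim \<omega>)
    then show ?case using q_eq_pieces[OF e, of "?X \<omega>"] by metis
  qed
  \<comment> \<open>Almost sure agreement with \<open>q_pieces\<close> transfers integrability once
    \<open>q\<close> itself is known to be measurable.\<close>
  have meas: "(\<lambda>\<omega>. q (?X \<omega>) e) \<in> borel_measurable M"
    using measurable_compose[OF _ q_measurable[OF e], of ?X M] by simp
  have pieces_int: "integrable M (\<lambda>\<omega>. q_pieces (?X \<omega>) e)"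
    unfolding q_pieces_def by (intro Bochner_Integration.integrable_add pieces)
  have q_int: "integrable M (\<lambda>\<omega>. q (?X \<omega>) e)"
    by (rule integrable_cong_AE_imp[OF pieces_int meas ae])
  have "(\<integral>\<omega>. q (?X \<omega>) e \<partial>M) = (\<integral>\<omega>. q_pieces (?X \<omega>) e \<partial>M)"
    using ae by (intro integral_cong_AE borel_measurable_integrable[OF pieces_int] meas) auto
  \<comment> \<open>The outer intervals have probabilities \<open>?F ?a - 0\<close> and
    \<open>1 - ?F ?d\<close>, by the values of \<open>cdf_ext\<close> at the infinities.\<close>
  also have "\<dots> = real_of_ereal (v (e + P * \<eta>)) * ?F ?a + 1 / \<eta> * (LBINT u=?a..?b. u * f t u)
      + w e * (?F ?c - ?F ?b)
      + (\<eta> * (LBINT u=?c..?d. u * f t u) - c * \<eta> * (?F ?d - ?F ?c))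
      + real_of_ereal (v (e - P / \<eta>)) * (1 - ?F ?d)"
    unfolding q_pieces_def
    by (simp only: Bochner_Integration.integral_add Bochner_Integration.integrable_add pieces)
      (simp add: cdf_ext_def[of _ "\<infinity>"] cdf_ext_def[of _ "- \<infinity>"])
  finally have total: "(\<integral>\<omega>. q (?X \<omega>) e \<partial>M) = \<dots>" .
  \<comment> \<open>If \<open>e + P * \<eta> > E\<close>, the slope is \<open>- \<infinity>\<close>
    and its probability is \<open>0\<close>; the product in \<open>ereal\<close> is
    \<open>0\<close>, in agreement with \<open>real_of_ereal\<close>.\<close>
  have first: "v (e + P * \<eta>) * ereal (?F ?a) = ereal (real_of_ereal (v (e + P * \<eta>)) * ?F ?a)"
  proof (cases "e + P * \<eta> \<le> E")
    case True
    then have "e + P * \<eta> \<in> {0..E}" using e P_pos \<eta>_pos by simp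
    then show ?thesis by (simp add: v_eq)
  next
    case False
    then have "?a = - \<infinity>" by (intro charge_bound_above) simp
    then have "?F ?a = 0" by (simp only: cdf_ext_def) simp
    then show ?thesis by (simp flip: zero_ereal_def)
  qed
  \<comment> \<open>Symmetrically, the slope \<open>\<infinity>\<close> below the empty state meets
    the weight \<open>1 - 1 = 0\<close>.\<close>
  have last: "v (e - P / \<eta>) * ereal (1 - ?F ?d) = ereal (real_of_ereal (v (e - P / \<eta>)) * (1 - ?F ?d))"
  proof (cases "0 \<le> e - P / \<eta>")
    case True
    moreover have "0 \<le> P / \<eta>" using P_pos \<eta>_pos by simp
    ultimately have "e - P / \<eta> \<in> {0..E}" using e by auto
    then show ?thesis by (simp add: v_eq)
  next
    case False
    then have "?d = \<infinity>" by (intro discharge_bound_below) simp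
    then have "?F ?d = 1" by (simp only: cdf_ext_def) simp
    then show ?thesis by (simp flip: zero_ereal_def)
  qed
  show ?thesis
    unfolding Let_def first last v_eq[OF e] total using q_int by (simp add: algebra_simps)
qed

end
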